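(* For $\alpha\in\mathbb{R}$ and $x>0$ let $\operatorname{Ki}_{\alpha}(x)=\int_0^{\infty}e^{-x\cosh t}(\cosh t)^{-\alpha}\,dt$. If $\alpha\in\mathbb{R}$ and $n\in\{1,2,\dots\}$, then the function $$x\mapsto\left|\begin{array}{cccc}\operatorname{Ki}_{\alpha}(x)&\operatorname{Ki}_{\alpha-1}(x)&\cdots&\operatorname{Ki}_{\alpha-n}(x)\\ \operatorname{Ki}_{\alpha-1}(x)&\operatorname{Ki}_{\alpha-2}(x)&\cdots&\operatorname{Ki}_{\alpha-n-1}(x)\\ \vdots&\vdots&&\vdots\\ \operatorname{Ki}_{\alpha-n}(x)&\operatorname{Ki}_{\alpha-n-1}(x)&\cdots&\operatorname{Ki}_{\alpha-2n}(x)\end{array}\right|,$$ i.e. the determinant of the $(n+1)\times(n+1)$ matrix $\left(\operatorname{Ki}_{\alpha-j-k}(x)\right)_{j,k=0}^{n}$, is completely monotonic on $(0,\infty)$.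
   Context: $\operatorname{Ki}_{\alpha}$ is the Bickley function, defined for every real $\alpha$ and $x>0$ by the integral in the claim. A function $f:(0,\infty)\to\mathbb{R}$ is completely monotonic if it has derivatives of all orders and $(-1)^mf^{(m)}(x)\geq0$ for all $x>0$ and $m\in\{0,1,2,\dots\}$. *)

theory Defs
  imports "HOL-Analysis.Analysis" "Jordan_Normal_Form.Determinant"
begin

(* The integrand is nonnegative and integrable for every x > 0; no claim is made for x <= 0. *)
definition Ki :: "real \<Rightarrow> real \<Rightarrow> real" where
  "Ki \<alpha> x = (LBINT t:{0..}. exp (- x * cosh t) * cosh t powr (- \<alpha>))"

(* f is total, but only its values on the open set {0<..} matter: deriv is a local notion there. *)
definition completely_monotonic :: "(real \<Rightarrow> real) \<Rightarrow> bool" where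
  "completely_monotonic f \<longleftrightarrow>
     (\<forall>m. \<forall>x>0. (deriv ^^ m) f field_differentiable (at x)) \<and>
     (\<forall>m. \<forall>x>0. (- 1) ^ m * (deriv ^^ m) f x \<ge> 0)"

(* HOL-Analysis has matrices and determinants over index types, under the same base names.
   The qualified names select those with natural-number dimensions. *)
definition Ki_det :: "real \<Rightarrow> nat \<Rightarrow> real \<Rightarrow> real" where
  "Ki_det \<alpha> n x =
     Determinant.det (Matrix.mat (n + 1) (n + 1) (\<lambda>(j, k). Ki (\<alpha> - real j - real k) x))"

end

theory Submission
  imports Defs
begin

text \<open>By Andreief's identity the Hankel determinant is an integral over the \<^term>\<open>n + 1\<close>-fold product
  of the half-line: with \<open>c\<^sub>i = cosh t\<^sub>i\<close>,
  \<open>(n+1)! det = \<integral> exp (- x (c\<^sub>0 + \<dots> + c\<^sub>n)) (c\<^sub>0 \<cdots> c\<^sub>n) powr (- \<alpha>) det (c\<^sub>i ^ j)\<^sup>2 dt\<close>.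
  This is a Laplace transform in \<open>x\<close> of a nonnegative measure, and such transforms are completely
  monotonic by differentiation under the integral sign.\<close>

section \<open>Laplace transforms\<close>

text \<open>From \<open>u \<le> exp u\<close> at \<open>u = x / 2 * g\<close>: half of the
  exponential decay absorbs the factor \<open>g\<close>, so a moment integrand at \<open>x\<close>
  is controlled by the Laplace integrand at \<open>x / 2\<close>.\<close>

lemma mult_exp_minus_le:
  fixes x g :: real
  assumes "x > 0" "g \<ge> 0"
  shows "g * exp (- x * g) \<le> 2 / x * exp (- (x / 2) * g)"
proof -
  have "x / 2 * g \<le> exp (x / 2 * g)"
    using exp_ge_add_one_self[of "x / 2 * g"] by linarith
  then have "x / 2 * g * exp (- x * g) \<le> exp (x / 2 * g) * exp (- x * g)"
    by (intro mult_right_mono) auto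
  also have "\<dots> = exp (- (x / 2) * g)"
    by (simp add: exp_add[symmetric] algebra_simps)
  finally show ?thesis
    using assms(1) by (simp add: field_simps)
qed

text \<open>Mean value estimate: the slope of \<open>exp (- z * g)\<close> has absolute value
  \<open>g * exp (- z * g)\<close>, which on \<open>{a..}\<close> is largest at \<open>a\<close>.
  The bound is free of \<open>y\<close>, as a dominating function requires. For \<open>x = y\<close>
  the quotient is 0, since division by 0 gives 0.\<close>

lemma exp_difference_quotient_bound:
  fixes a x y g :: real
  assumes "a \<le> x" "a \<le> y" "g \<ge> 0"
  shows "\<bar>(exp (- y * g) - exp (- x * g)) / (y - x)\<bar> \<le> g * exp (- a * g)"
proof (cases "x = y")
  case False
  have "norm (exp (- y * g) - exp (- x * g)) \<le> (g * exp (- a * g)) * norm (y - x)"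
  proof (rule field_differentiable_bound[where S = "{a..}" and f' = "\<lambda>z. - g * exp (- z * g)"])
    show "((\<lambda>z. exp (- z * g)) has_field_derivative - g * exp (- z * g)) (at z within {a..})" for z
      by (auto intro!: derivative_eq_intros)
    show "norm (- g * exp (- z * g)) \<le> g * exp (- a * g)" if "z \<in> {a..}" for z
      using that assms(3) by (auto simp: abs_mult intro!: mult_left_mono mult_right_mono)
  qed (use assms in auto)
  with False show ?thesis
    by (simp add: field_simps abs_divide)
qed (use assms in auto)

lemma laplace_moment_integrable:
  fixes g h :: "'a \<Rightarrow> real"
  assumes [measurable]: "g \<in> borel_measurable M" "h \<in> borel_measurable M"
    and g: "\<And>t. g t \<ge> 0"
    and int: "\<And>x. x > 0 \<Longrightarrow> integrable M (\<lambda>t. exp (- x * g t) * h t)"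
    and x: "x > 0"
  shows "integrable M (\<lambda>t. exp (- x * g t) * (g t * h t))"
proof (rule Bochner_Integration.integrable_bound)
  show "integrable M (\<lambda>t. 2 / x * (exp (- (x / 2) * g t) * h t))"
    using int[of "x / 2"] x by (intro integrable_mult_right) simp
  show "AE t in M. norm (exp (- x * g t) * (g t * h t)) \<le> norm (2 / x * (exp (- (x / 2) * g t) * h t))"
  proof (intro AE_I2)
    fix t
    have "norm (exp (- x * g t) * (g t * h t)) = g t * exp (- x * g t) * \<bar>h t\<bar>"
      using g[of t] by (simp add: abs_mult)
    also have "\<dots> \<le> 2 / x * exp (- (x / 2) * g t) * \<bar>h t\<bar>"
      by (intro mult_right_mono mult_exp_minus_le x g) auto
    finally show "norm (exp (- x * g t) * (g t * h t)) \<le> norm (2 / x * (exp (- (x / 2) * g t) * h t))"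
      using x by (simp add: abs_mult)
  qed
qed measurable

text \<open>Differentiation under the integral sign: dominated convergence is applied to difference
  quotients along arbitrary sequences tending to \<open>x\<close>. The weight \<open>h\<close> may
  change sign here.\<close>

lemma laplace_has_derivative:
  fixes g h :: "'a \<Rightarrow> real"
  assumes [measurable]: "g \<in> borel_measurable M" "h \<in> borel_measurable M"
    and g: "\<And>t. g t \<ge> 0"
    and int: "\<And>x. x > 0 \<Longrightarrow> integrable M (\<lambda>t. exp (- x * g t) * h t)"
    and x: "x > 0"
  shows "((\<lambda>x. \<integral>t. exp (- x * g t) * h t \<partial>M) has_field_derivative
          - (\<integral>t. exp (- x * g t) * (g t * h t) \<partial>M)) (at x)"
proof -
  let ?F = "\<lambda>x. \<integral>t. exp (- x * g t) * h t \<partial>M"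
  let ?q = "\<lambda>y t. (exp (- y * g t) - exp (- x * g t)) / (y - x) * h t"
  \<comment> \<open>Staying to the right of \<open>x / 2\<close> keeps the sequences away from 0, so
    one function, the moment integrand at \<open>x / 2\<close>, dominates all the quotients.\<close>
  have "((\<lambda>y. (?F y - ?F x) / (y - x)) \<longlongrightarrow> - (\<integral>t. exp (- x * g t) * (g t * h t) \<partial>M))
          (at x within {x/2<..})"
    unfolding tendsto_at_iff_sequentially
  proof (intro allI impI)
    fix X assume X: "\<forall>i. X i \<in> {x/2<..} - {x}" and lim: "X \<longlonglongrightarrow> x"
    have eq: "(?F (X i) - ?F x) / (X i - x) = (\<integral>t. ?q (X i) t \<partial>M)" for i
    proof -
      have "X i > 0"
        using X x by (smt (verit) Diff_iff field_sum_of_halves greaterThan_iff)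
      then have "(\<integral>t. ?q (X i) t \<partial>M) =
                 (\<integral>t. (exp (- X i * g t) * h t - exp (- x * g t) * h t) / (X i - x) \<partial>M)"
        by (intro Bochner_Integration.integral_cong) (auto simp: algebra_simps diff_divide_distrib)
      also have "\<dots> = (?F (X i) - ?F x) / (X i - x)"
        using int[OF \<open>X i > 0\<close>] int[OF x] by simp
      finally show ?thesis by (rule sym)
    qed
    have "(\<lambda>i. \<integral>t. ?q (X i) t \<partial>M) \<longlonglongrightarrow> (\<integral>t. - g t * exp (- x * g t) * h t \<partial>M)"
    proof (rule integral_dominated_convergence)
      show "integrable M (\<lambda>t. \<bar>exp (- (x / 2) * g t) * (g t * h t)\<bar>)"
        by (intro integrable_abs laplace_moment_integrable int g) (use x in auto)
      show "AE t in M. (\<lambda>i. ?q (X i) t) \<longlonglongrightarrow> - g t * exp (- x * g t) * h t"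
      proof (intro AE_I2 tendsto_mult tendsto_const)
        fix t
        have "((\<lambda>y. exp (- y * g t)) has_field_derivative - g t * exp (- x * g t)) (at x)"
          by (auto intro!: derivative_eq_intros)
        then show "(\<lambda>i. (exp (- X i * g t) - exp (- x * g t)) / (X i - x))
                     \<longlonglongrightarrow> - g t * exp (- x * g t)"
          using X lim unfolding has_field_derivative_iff tendsto_at_iff_sequentially
          by (auto simp: o_def)
      qed
      show "AE t in M. norm (?q (X i) t) \<le> \<bar>exp (- (x / 2) * g t) * (g t * h t)\<bar>" for i
      proof (intro AE_I2)
        fix t
        have "\<bar>(exp (- X i * g t) - exp (- x * g t)) / (X i - x)\<bar> \<le> g t * exp (- (x / 2) * g t)"
          using X x g by (intro exp_difference_quotient_bound) (auto intro: less_imp_le)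
        then have "\<bar>(exp (- X i * g t) - exp (- x * g t)) / (X i - x)\<bar> * \<bar>h t\<bar>
                     \<le> g t * exp (- (x / 2) * g t) * \<bar>h t\<bar>"
          by (rule mult_right_mono) auto
        then show "norm (?q (X i) t) \<le> \<bar>exp (- (x / 2) * g t) * (g t * h t)\<bar>"
          using g[of t] by (simp add: abs_mult mult_ac)
      qed
    qed measurable
    also have "(\<integral>t. - g t * exp (- x * g t) * h t \<partial>M) = - (\<integral>t. exp (- x * g t) * (g t * h t) \<partial>M)"
      by (subst Bochner_Integration.integral_minus[symmetric])
         (auto intro!: Bochner_Integration.integral_cong)
    finally show "((\<lambda>y. (?F y - ?F x) / (y - x)) \<circ> X)
                    \<longlonglongrightarrow> - (\<integral>t. exp (- x * g t) * (g t * h t) \<partial>M)"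
      by (simp only: o_def eq)
  qed
  \<comment> \<open>The half-line \<open>{x/2<..}\<close> is an open neighbourhood of
    \<open>x\<close>, so the restricted limit is the full one.\<close>
  then show ?thesis
    using x by (simp add: has_field_derivative_iff at_within_open[of x "{x/2<..}"])
qed

lemma laplace_power_integrable:
  fixes g h :: "'a \<Rightarrow> real"
  assumes [measurable]: "g \<in> borel_measurable M" "h \<in> borel_measurable M"
    and g: "\<And>t. g t \<ge> 0"
    and int: "\<And>x. x > 0 \<Longrightarrow> integrable M (\<lambda>t. exp (- x * g t) * h t)"
    and x: "x > 0"
  shows "integrable M (\<lambda>t. exp (- x * g t) * (g t ^ m * h t))"
  using x
proof (induction m arbitrary: x)
  case 0
  then show ?case using int by simp
next
  case (Suc m)
  have "integrable M (\<lambda>t. exp (- x * g t) * (g t * (g t ^ m * h t)))"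
    by (rule laplace_moment_integrable) (use Suc g in auto)
  then show ?case by (simp add: mult_ac)
qed

text \<open>Each differentiation multiplies the weight by \<open>- g\<close>. Hence the m-th
  derivative is \<open>(- 1) ^ m\<close> times the integral of a nonnegative function.\<close>

lemma completely_monotonic_laplace:
  fixes g h :: "'a \<Rightarrow> real"
  assumes [measurable]: "g \<in> borel_measurable M" "h \<in> borel_measurable M"
    and g: "\<And>t. g t \<ge> 0" and h: "\<And>t. h t \<ge> 0"
    and int: "\<And>x. x > 0 \<Longrightarrow> integrable M (\<lambda>t. exp (- x * g t) * h t)"
    and f: "\<And>x. x > 0 \<Longrightarrow> f x = (\<integral>t. exp (- x * g t) * h t \<partial>M)"
  shows "completely_monotonic f"
proof -
  define F where "F = (\<lambda>m x. (- 1) ^ m * (\<integral>t. exp (- x * g t) * (g t ^ m * h t) \<partial>M))"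
  have F: "(F m has_field_derivative F (Suc m) x) (at x)" if "x > 0" for m x
  proof -
    have "((\<lambda>x. \<integral>t. exp (- x * g t) * (g t ^ m * h t) \<partial>M) has_field_derivative
            - (\<integral>t. exp (- x * g t) * (g t * (g t ^ m * h t)) \<partial>M)) (at x)"
      by (rule laplace_has_derivative[OF _ _ g laplace_power_integrable[OF _ _ g int] that]) measurable
    then have "(F m has_field_derivative
        (- 1) ^ m * - (\<integral>t. exp (- x * g t) * (g t * (g t ^ m * h t)) \<partial>M)) (at x)"
      unfolding F_def by (rule DERIV_cmult)
    then show ?thesis
      by (simp add: F_def mult_ac)
  qed
  have eq: "(deriv ^^ m) f x = F m x" if "x > 0" for m x
    using that
  proof (induction m arbitrary: x)
    case 0
    then show ?case by (simp add: F_def f)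
  next
    case (Suc m)
    \<comment> \<open>The induction hypothesis identifies the m-th derivative with
      \<open>F m\<close> on the positive half-line only; that set is open, so the derivative carries
      over.\<close>
    have "((deriv ^^ m) f has_field_derivative F (Suc m) x) (at x)"
      by (rule has_field_derivative_transform_within_open[OF F[of x m], where S = "{0<..}"])
         (use Suc in auto)
    then show ?case
      by (simp add: DERIV_imp_deriv)
  qed
  have "((deriv ^^ m) f has_field_derivative F (Suc m) x) (at x)" if "x > 0" for m x
    by (rule has_field_derivative_transform_within_open[OF F[of x m], where S = "{0<..}"])
       (use that eq in auto)
  moreover have "(- 1) ^ m * (deriv ^^ m) f x \<ge> 0" if "x > 0" for m x
  proof -
    have "(- 1) ^ m * (deriv ^^ m) f x = (\<integral>t. exp (- x * g t) * (g t ^ m * h t) \<partial>M)"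
      by (simp add: eq[OF that] F_def mult.assoc[symmetric] power_mult_distrib[symmetric])
    also have "\<dots> \<ge> 0"
      using g h by (intro Bochner_Integration.integral_nonneg) auto
    finally show ?thesis .
  qed
  ultimately show ?thesis
    unfolding completely_monotonic_def field_differentiable_def by blast
qed

section \<open>Andreief's identity\<close>

lemma det_mat_eq_sum:
  fixes a :: "nat \<Rightarrow> nat \<Rightarrow> 'a::comm_ring_1"
  shows "Determinant.det (Matrix.mat N N (\<lambda>(i, j). a i j)) =
         (\<Sum>p | p permutes {0..<N}. signof p * (\<Prod>i=0..<N. a i (p i)))"
proof -
  have "p i < N" if "p permutes {0..<N}" "i < N" for p i
    using that permutes_in_image[of p "{0..<N}" i] by auto
  then show ?thesis
    by (subst det_def'[of _ N]) (auto intro!: sum.cong prod.cong)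
qed

text \<open>Both determinants are expanded by the Leibniz formula, and Fubini splits each term into
  one-dimensional integrals. For fixed \<open>p\<close>, the sum over \<open>q\<close> is the
  determinant of moments with its rows permuted by \<open>p\<close>; the two signs of
  \<open>p\<close> cancel, and each of the \<open>fact N\<close> permutations contributes the same
  value.\<close>

lemma andreief:
  fixes f g :: "nat \<Rightarrow> 'a \<Rightarrow> real"
  assumes M: "sigma_finite_measure M"
    and int: "\<And>i j. i < N \<Longrightarrow> j < N \<Longrightarrow> integrable M (\<lambda>t. f i t * g j t)"
  defines "D \<equiv> (\<lambda>f t. Determinant.det (Matrix.mat N N (\<lambda>(i, j). f j (t i))) :: real)"
  shows "integrable (Pi\<^sub>M {0..<N} (\<lambda>_. M)) (\<lambda>t. D f t * D g t)"
    and "(\<integral>t. D f t * D g t \<partial>Pi\<^sub>M {0..<N} (\<lambda>_. M)) =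
         fact N * Determinant.det (Matrix.mat N N (\<lambda>(i, j). \<integral>t. f i t * g j t \<partial>M))"
proof -
  interpret product_sigma_finite "\<lambda>_::nat. M"
    using M by (simp add: product_sigma_finite_def)
  let ?P = "{p. p permutes {0..<N}}"
  let ?A = "Matrix.mat N N (\<lambda>(i, j). \<integral>t. f i t * g j t \<partial>M)"
  have perm: "p i < N" if "p \<in> ?P" "i < N" for p i
    using that permutes_in_image[of p "{0..<N}" i] by auto
  have D: "D u t = (\<Sum>p\<in>?P. signof p * (\<Prod>i=0..<N. u (p i) (t i)))" for u :: "nat \<Rightarrow> 'a \<Rightarrow> real" and t
    unfolding D_def by (rule det_mat_eq_sum)
  have DD: "D f t * D g t =
      (\<Sum>p\<in>?P. \<Sum>q\<in>?P. signof p * signof q * (\<Prod>i=0..<N. f (p i) (t i) * g (q i) (t i)))" for t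
    by (simp add: D sum_product prod.distrib mult_ac)
  have int': "integrable M (\<lambda>t. f (p i) t * g (q i) t)" if "p \<in> ?P" "q \<in> ?P" "i \<in> {0..<N}" for p q i
    using that perm[of p i] perm[of q i] by (intro int) auto
  have term_int: "integrable (Pi\<^sub>M {0..<N} (\<lambda>_. M)) (\<lambda>t. \<Prod>i=0..<N. f (p i) (t i) * g (q i) (t i))"
    if "p \<in> ?P" "q \<in> ?P" for p q
    using that int' by (intro product_integrable_prod) auto
  show "integrable (Pi\<^sub>M {0..<N} (\<lambda>_. M)) (\<lambda>t. D f t * D g t)"
    unfolding DD by (intro Bochner_Integration.integrable_sum integrable_mult_right term_int)
  have "(\<integral>t. D f t * D g t \<partial>Pi\<^sub>M {0..<N} (\<lambda>_. M)) =
    (\<Sum>p\<in>?P. \<Sum>q\<in>?P. signof p * signof q *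
      (\<integral>t. (\<Prod>i=0..<N. f (p i) (t i) * g (q i) (t i)) \<partial>Pi\<^sub>M {0..<N} (\<lambda>_. M)))"
    unfolding DD
    by (subst Bochner_Integration.integral_sum,
        (intro Bochner_Integration.integrable_sum integrable_mult_right term_int; assumption),
        intro sum.cong refl,
        subst Bochner_Integration.integral_sum,
        (intro integrable_mult_right term_int; assumption)) simp
  also have "\<dots> = (\<Sum>p\<in>?P. \<Sum>q\<in>?P. signof p * signof q *
      (\<Prod>i=0..<N. \<integral>t. f (p i) t * g (q i) t \<partial>M))"
    by (intro sum.cong refl arg_cong2[where f = "(*)"] product_integral_prod int') auto
  also have "\<dots> = (\<Sum>p\<in>?P. Determinant.det ?A)"
  proof (intro sum.cong refl)
    fix p assume p: "p \<in> ?P"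
    \<comment> \<open>Read backwards, the Leibniz formula turns the sum over \<open>q\<close> into
      the determinant of \<open>?A\<close> with row \<open>p i\<close> in place
      \<open>i\<close>.\<close>
    have "(\<Sum>q\<in>?P. signof p * signof q * (\<Prod>i=0..<N. \<integral>t. f (p i) t * g (q i) t \<partial>M)) =
      signof p * Determinant.det (Matrix.mat N N (\<lambda>(i, j). ?A $$ (p i, j)))"
      unfolding det_mat_eq_sum using perm p
      by (auto simp: sum_distrib_left mult.assoc intro!: sum.cong prod.cong)
    also have "\<dots> = signof p * (signof p * Determinant.det ?A)"
      using p by (subst det_permute_rows) auto
    also have "\<dots> = Determinant.det ?A"
      by (simp add: sign_def)
    finally show "(\<Sum>q\<in>?P. signof p * signof q * (\<Prod>i=0..<N. \<integral>t. f (p i) t * g (q i) t \<partial>M)) =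
      Determinant.det ?A" .
  qed
  also have "\<dots> = fact N * Determinant.det ?A"
    by (simp add: card_permutations[of _ N])
  finally show "(\<integral>t. D f t * D g t \<partial>Pi\<^sub>M {0..<N} (\<lambda>_. M)) = fact N * Determinant.det ?A" .
qed

text \<open>Every Leibniz term takes one entry from each row, hence carries the whole product of the
  weights. This extracts the weights at the points \<open>t i\<close>.\<close>

lemma det_scale_rows:
  fixes w :: "nat \<Rightarrow> 'a::comm_ring_1"
  shows "Determinant.det (Matrix.mat N N (\<lambda>(i, j). w i * a i j)) =
         (\<Prod>i=0..<N. w i) * Determinant.det (Matrix.mat N N (\<lambda>(i, j). a i j))"
  by (simp add: det_mat_eq_sum sum_distrib_left prod.distrib mult_ac)

section \<open>The Bickley function\<close>

lemma powr_le_exp_linear: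
  fixes a s :: real
  assumes "s > 0"
  obtains C where "C \<ge> 0" "\<And>u. u \<ge> 1 \<Longrightarrow> u powr a \<le> C * exp (s * u)"
proof
  \<comment> \<open>The inequality \<open>ln v \<le> v - 1\<close> at \<open>v = r * u\<close>
    bounds \<open>ln u\<close> by a line of slope \<open>r\<close>; this \<open>r\<close> makes the
    slope after multiplication by \<open>\<bar>a\<bar>\<close> at most \<open>s\<close>. Adding 1
    covers \<open>a = 0\<close>.\<close>
  define r where "r = s / (\<bar>a\<bar> + 1)"
  have r: "r > 0" using assms by (simp add: r_def)
  show "exp (\<bar>a\<bar> * \<bar>ln r\<bar>) \<ge> 0" by simp
  show "u powr a \<le> exp (\<bar>a\<bar> * \<bar>ln r\<bar>) * exp (s * u)" if u: "u \<ge> 1" for u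
  proof -
    have "ln (r * u) \<le> r * u - 1"
      using r u by (intro ln_le_minus_one) auto
    then have ln: "ln u \<le> r * u + \<bar>ln r\<bar>"
      using r u by (simp add: ln_mult)
    have "a * ln u \<le> \<bar>a\<bar> * ln u"
      using u by (intro mult_right_mono) auto
    also have "\<dots> \<le> \<bar>a\<bar> * (r * u + \<bar>ln r\<bar>)"
      using ln by (intro mult_left_mono) auto
    also have "\<dots> \<le> (\<bar>a\<bar> + 1) * r * u + \<bar>a\<bar> * \<bar>ln r\<bar>"
      using r u by (simp add: algebra_simps)
    also have "(\<bar>a\<bar> + 1) * r = s"
      by (simp add: r_def)
    finally show ?thesis
      using u by (simp add: powr_def exp_add[symmetric] add.commute)
  qed
qed

lemma cosh_ge_self: "x \<le> cosh (x::real)"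
proof (cases "x \<ge> 0")
  case True
  have "1 + x + x\<^sup>2 / 2 \<le> exp x"
    using True by (rule exp_lower_Taylor_quadratic)
  \<comment> \<open>Completing the square:
    \<open>1 + x + x^2 / 2 - 2 * x = ((x - 1)^2 + 1) / 2\<close>.\<close>
  moreover have "0 \<le> (x - 1)\<^sup>2"
    by simp
  ultimately have "2 * x \<le> exp x"
    by (simp add: power2_diff)
  then have "2 * x \<le> exp x + exp (- x)"
    by (rule add_increasing2[OF exp_ge_zero])
  then show ?thesis
    by (simp add: cosh_field_def)
next
  case False
  then show ?thesis using cosh_real_ge_1[of x] by linarith
qed

text \<open>Half of the decay absorbs the power of \<open>cosh t\<close>, whatever the sign of
  \<alpha>; the other half is at most \<open>exp (- (x / 2) * t)\<close> because
  \<open>t \<le> cosh t\<close>.\<close>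

lemma Ki_integrable:
  fixes \<alpha> x :: real
  assumes x: "x > 0"
  shows "set_integrable lborel {0..} (\<lambda>t. exp (- x * cosh t) * cosh t powr (- \<alpha>))"
proof -
  obtain C where C: "C \<ge> 0" "\<And>u. u \<ge> 1 \<Longrightarrow> u powr (- \<alpha>) \<le> C * exp (x / 2 * u)"
    using powr_le_exp_linear[of "x / 2" "- \<alpha>"] x by auto
  have "set_integrable lebesgue {0..} (\<lambda>t. exp (- (x / 2) * t))"
    using x by (intro nonnegative_absolutely_integrable_1 integrable_on_exp_minus_to_infinity) auto
  \<comment> \<open>The integrand is Borel measurable, so integrability passes from the completed
    measure back to \<open>lborel\<close>.\<close>
  then have e: "set_integrable lborel {0..} (\<lambda>t. exp (- (x / 2) * t))"
    unfolding set_integrable_def by (subst (asm) integrable_completion) auto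
  show ?thesis
    unfolding set_integrable_def
  proof (rule Bochner_Integration.integrable_bound)
    show "integrable lborel (\<lambda>t. C * (indicator {0..} t *\<^sub>R exp (- (x / 2) * t)))"
      using e unfolding set_integrable_def by (rule integrable_mult_right)
    show "(\<lambda>t. indicator {0..} t *\<^sub>R (exp (- x * cosh t) * cosh t powr (- \<alpha>))) \<in> borel_measurable lborel"
      unfolding cosh_def by measurable
    show "AE t in lborel. norm (indicator {0..} t *\<^sub>R (exp (- x * cosh t) * cosh t powr (- \<alpha>)))
            \<le> norm (C * (indicator {0..} t *\<^sub>R exp (- (x / 2) * t)))"
    proof (intro AE_I2)
      fix t :: real
      have "exp (- x * cosh t) * cosh t powr (- \<alpha>) \<le> exp (- x * cosh t) * (C * exp (x / 2 * cosh t))"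
        by (intro mult_left_mono C cosh_real_ge_1) auto
      also have "\<dots> = C * exp (- (x / 2) * cosh t)"
        by (simp add: exp_add[symmetric] algebra_simps)
      also have "\<dots> \<le> C * exp (- (x / 2) * t)"
        using x C cosh_ge_self[of t] by (intro mult_left_mono) auto
      finally show "norm (indicator {0..} t *\<^sub>R (exp (- x * cosh t) * cosh t powr (- \<alpha>)))
            \<le> norm (C * (indicator {0..} t *\<^sub>R exp (- (x / 2) * t)))"
        using C by (auto simp: indicator_def abs_mult)
    qed
  qed
qed

text \<open>Andreief's identity for the powers of \<open>cosh\<close>, with the Bickley weight. The
  Vandermonde determinant \<open>V\<close> occurs once from each family, which gives the square; the
  indicators in \<open>h\<close> encode the half-line, and \<open>x\<close> occurs only in the
  exponential.\<close>

lemma Ki_det_integral: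
  fixes \<alpha> x :: real and n :: nat
  defines "V \<equiv> (\<lambda>t. Determinant.det (Matrix.mat (n + 1) (n + 1) (\<lambda>(i, j). cosh (t i :: real) ^ j)))"
  defines "h \<equiv> (\<lambda>t. (\<Prod>i=0..<n+1. indicator {0..} (t i) * cosh (t i) powr (- \<alpha>)) * (V t)\<^sup>2 / fact (n + 1))"
  defines "P \<equiv> Pi\<^sub>M {0..<n+1} (\<lambda>_. lborel)"
  assumes x: "x > 0"
  shows "integrable P (\<lambda>t. exp (- x * (\<Sum>i=0..<n+1. cosh (t i))) * h t)"
    and "Ki_det \<alpha> n x = (\<integral>t. exp (- x * (\<Sum>i=0..<n+1. cosh (t i))) * h t \<partial>P)"
proof -
  \<comment> \<open>The whole weight goes into \<open>f\<close> and none into \<open>g\<close>, so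
    each product \<open>f i t * g j t\<close> contains it exactly once.\<close>
  define w where "w = (\<lambda>t::real. indicator {0..} t * (exp (- x * cosh t) * cosh t powr (- \<alpha>)))"
  define f where "f = (\<lambda>j t. w t * cosh t ^ j)"
  define g where "g = (\<lambda>j t. cosh (t::real) ^ j)"
  \<comment> \<open>Multiplying by a power of \<open>cosh t\<close> lowers the order of the Bickley
    function, which produces the Hankel entries.\<close>
  have pow: "cosh t powr (- \<alpha>) * cosh t ^ j * cosh t ^ k = cosh t powr (- (\<alpha> - real j - real k))"
    for j k and t :: real
    by (simp add: powr_realpow[symmetric] powr_add[symmetric] cosh_real_pos algebra_simps)
  have fg: "f i t * g j t =
      indicator {0..} t *\<^sub>R (exp (- x * cosh t) * cosh t powr (- (\<alpha> - real i - real j)))" for i j t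
    by (subst pow[symmetric]) (simp add: f_def g_def w_def mult_ac)
  have int: "integrable lborel (\<lambda>t. f i t * g j t)" for i j
    unfolding fg by (rule Ki_integrable[OF x, unfolded set_integrable_def])
  have Ki: "(\<integral>t. f i t * g j t \<partial>lborel) = Ki (\<alpha> - real i - real j) x" for i j
    unfolding fg Ki_def set_lebesgue_integral_def ..
  have "Determinant.det (Matrix.mat (n + 1) (n + 1) (\<lambda>(i, j). f j (t i))) *
        Determinant.det (Matrix.mat (n + 1) (n + 1) (\<lambda>(i, j). g j (t i))) =
        fact (n + 1) * (exp (- x * (\<Sum>i=0..<n+1. cosh (t i))) * h t)" for t
  proof -
    have "(\<Prod>i=0..<n+1. w (t i)) =
        exp (- x * (\<Sum>i=0..<n+1. cosh (t i))) * (\<Prod>i=0..<n+1. indicator {0..} (t i) * cosh (t i) powr (- \<alpha>))"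
      unfolding w_def sum_distrib_left
      by (subst exp_sum) (simp_all add: prod.distrib mult_ac del: prod.op_ivl_Suc)
    then show ?thesis
      unfolding f_def g_def det_scale_rows h_def V_def
      by (simp add: power2_eq_square del: prod.op_ivl_Suc sum.op_ivl_Suc fact_Suc)
  qed
  then have eq: "exp (- x * (\<Sum>i=0..<n+1. cosh (t i))) * h t =
      Determinant.det (Matrix.mat (n + 1) (n + 1) (\<lambda>(i, j). f j (t i))) *
      Determinant.det (Matrix.mat (n + 1) (n + 1) (\<lambda>(i, j). g j (t i))) / fact (n + 1)" for t
    by (simp del: prod.op_ivl_Suc sum.op_ivl_Suc fact_Suc)
  note A = andreief[of lborel "n + 1" f g, OF lborel.sigma_finite_measure_axioms int, folded P_def]
  show "integrable P (\<lambda>t. exp (- x * (\<Sum>i=0..<n+1. cosh (t i))) * h t)"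
    unfolding eq by (intro integrable_divide_zero A(1))
  show "Ki_det \<alpha> n x = (\<integral>t. exp (- x * (\<Sum>i=0..<n+1. cosh (t i))) * h t \<partial>P)"
    unfolding eq integral_divide_zero A(2) Ki_det_def Ki by (simp del: fact_Suc)
qed

theorem theorem3:
  fixes \<alpha> :: real and n :: nat
  assumes "n \<ge> 1"
  shows "completely_monotonic (\<lambda>x. Ki_det \<alpha> n x)"
\<comment> \<open>The two conclusions of \<open>Ki_det_integral\<close> supply integrability and the
  integral formula, and thereby fix \<open>g\<close> and \<open>h\<close>. Measurability and
  nonnegativity of these remain.\<close>
proof (rule completely_monotonic_laplace[OF _ _ _ _ Ki_det_integral])
  have [measurable]: "(cosh :: real \<Rightarrow> real) \<in> borel_measurable borel"
    unfolding cosh_def by measurable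
  show "(\<lambda>t. \<Sum>i=0..<n+1. cosh (t i :: real)) \<in> borel_measurable (Pi\<^sub>M {0..<n+1} (\<lambda>_. lborel))"
    by measurable
  show "(\<lambda>t. (\<Prod>i=0..<n+1. indicator {0..} (t i :: real) * cosh (t i) powr (- \<alpha>)) *
      (Determinant.det (Matrix.mat (n + 1) (n + 1) (\<lambda>(i, j). cosh (t i) ^ j)))\<^sup>2 / fact (n + 1))
    \<in> borel_measurable (Pi\<^sub>M {0..<n+1} (\<lambda>_. lborel))"
    \<comment> \<open>The Leibniz formula presents the determinant as a polynomial in the values
      \<open>cosh (t i)\<close>.\<close>
    unfolding det_mat_eq_sum by measurable
  show "(\<Sum>i=0..<n+1. cosh (t i)) \<ge> 0" for t :: "nat \<Rightarrow> real"
    by (intro sum_nonneg cosh_real_nonneg)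
  show "(\<Prod>i=0..<n+1. indicator {0..} (t i) * cosh (t i) powr (- \<alpha>)) *
      (Determinant.det (Matrix.mat (n + 1) (n + 1) (\<lambda>(i, j). cosh (t i) ^ j)))\<^sup>2 / fact (n + 1) \<ge> 0"
    for t :: "nat \<Rightarrow> real"
    by (intro divide_nonneg_nonneg mult_nonneg_nonneg prod_nonneg) auto
qed

end
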